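(* Let $(\mathcal L,\mathcal P)$ be an extremal configuration with a line weighted cell decomposition $C_1,\dots,C_{r^2}$, where $N^{1/3-}\lesssim r\lesssim N^{1/3}$. Then there is a subset $\mathcal P'\subset\mathcal P$ with $|\mathcal P'|\gtrsim N^{1-}$ such that $(\mathcal L,\mathcal P')$ is an extremal configuration and the nonempty elements of the list $C_1\cap\mathcal P',\dots,C_{r^2}\cap\mathcal P'$ form a point weighted cell decomposition.
   Context: Conventions: $N$ is a large parameter and $\epsilon_0>0$ a fixed small exponent. $A\lesssim B$ means $A\le CB$ with $C$ independent of $N$. $N^{a+}$ (resp. $N^{a-}$) denotes $N^{a+\epsilon}$ (resp. $N^{a-\epsilon}$) for some $0\le\epsilon\lesssim\epsilon_0$, possibly different at each occurrence. A configuration $(\mathcal L,\mathcal P)$ is a set $\mathcal L$ of lines and a set $\mathcal P$ of points in $\mathbb R^2$ with $N^{1-}\lesssim|\mathcal L|,|\mathcal P|\le N$; $I(\mathcal L,\mathcal P)$ is the set of incident pairs; it is extremal if $|I(\mathcal L,\mathcal P)|\gtrsim N^{4/3-}$. A partition of $\mathcal P$ into $r^2$ disjoint subsets (cells) $C_1,\dots,C_{r^2}$ is a line weighted cell decomposition if no line of $\mathcal L$ is incident to points in $\gtrsim r$ cells and no cell has $\gtrsim N^{1+}/r$ lines of $\mathcal L$ incident to any of its points. It is a point weighted cell decomposition if no line of $\mathcal L$ is incident to points in $\gtrsim r$ cells and no cell contains $\gtrsim N^{1+}/r^2$ points of $\mathcal P$. *)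

theory Defs
  imports "HOL-Analysis.Analysis"
begin

text \<open>
  Rendering of the asymptotic notation.  Every definition below carries a constant \<open>A\<close>, the
  implied constant of all its relations \<open>\<lesssim>\<close> and \<open>\<greatersim>\<close>, and a number \<open>\<delta> = K * \<epsilon>\<^sub>0\<close>, the admissible
  loss in the exponents: \<open>N\<^sup>a\<^sup>-\<close> stands for \<open>N powr (a - \<epsilon>)\<close> and \<open>N\<^sup>a\<^sup>+\<close> for \<open>N powr (a + \<epsilon>)\<close> for some
  \<open>\<epsilon> \<in> {0..\<delta>}\<close>, chosen separately at each occurrence.  ``No \<dots> has \<open>\<greatersim> X\<close> many'' is read as
  ``every \<dots> has at most \<open>A * X\<close> many''.
\<close>

definition is_line :: "(real^2) set \<Rightarrow> bool" where
  "is_line l \<longleftrightarrow> affine l \<and> aff_dim l = 1"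

definition configuration ::
    "real \<Rightarrow> real \<Rightarrow> real \<Rightarrow> (real^2) set set \<Rightarrow> (real^2) set \<Rightarrow> bool" where
  "configuration A \<delta> N L P \<longleftrightarrow>
     finite L \<and> finite P \<and> (\<forall>l\<in>L. is_line l) \<and>
     (\<exists>\<epsilon>\<in>{0..\<delta>}. N powr (1 - \<epsilon>) \<le> A * real (card L)) \<and> real (card L) \<le> N \<and>
     (\<exists>\<epsilon>\<in>{0..\<delta>}. N powr (1 - \<epsilon>) \<le> A * real (card P)) \<and> real (card P) \<le> N"

definition incidences ::
    "(real^2) set set \<Rightarrow> (real^2) set \<Rightarrow> ((real^2) set \<times> (real^2)) set" where
  "incidences L P = {(l, p). l \<in> L \<and> p \<in> P \<and> p \<in> l}"

definition extremal ::
    "real \<Rightarrow> real \<Rightarrow> real \<Rightarrow> (real^2) set set \<Rightarrow> (real^2) set \<Rightarrow> bool" where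
  "extremal A \<delta> N L P \<longleftrightarrow>
     configuration A \<delta> N L P \<and>
     (\<exists>\<epsilon>\<in>{0..\<delta>}. N powr (4/3 - \<epsilon>) \<le> A * real (card (incidences L P)))"

text \<open>
  The cells are a family indexed by \<open>I\<close>, some of which may be empty.  The bound on \<open>card I\<close> is an
  inequality because discarding the empty members of a list of \<open>r\<^sup>2\<close> cells must again give a
  decomposition with the same parameter \<open>r\<close>; a full list \<open>C 1, \<dots>, C (r\<^sup>2)\<close> has \<open>I = {1..r\<^sup>2}\<close>.
\<close>

definition cell_partition ::
    "nat \<Rightarrow> (real^2) set \<Rightarrow> nat set \<Rightarrow> (nat \<Rightarrow> (real^2) set) \<Rightarrow> bool" where
  "cell_partition r P I C \<longleftrightarrow>
     finite I \<and> card I \<le> r\<^sup>2 \<and> disjoint_family_on C I \<and> (\<Union>i\<in>I. C i) = P"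

definition few_cells_per_line ::
    "real \<Rightarrow> nat \<Rightarrow> (real^2) set set \<Rightarrow> nat set \<Rightarrow> (nat \<Rightarrow> (real^2) set) \<Rightarrow> bool" where
  "few_cells_per_line A r L I C \<longleftrightarrow>
     (\<forall>l\<in>L. real (card {i\<in>I. \<exists>p\<in>C i. p \<in> l}) \<le> A * real r)"

definition line_weighted_cell_decomposition ::
    "real \<Rightarrow> real \<Rightarrow> real \<Rightarrow> nat \<Rightarrow> (real^2) set set \<Rightarrow> (real^2) set \<Rightarrow> nat set \<Rightarrow>
      (nat \<Rightarrow> (real^2) set) \<Rightarrow> bool" where
  "line_weighted_cell_decomposition A \<delta> N r L P I C \<longleftrightarrow>
     cell_partition r P I C \<and> few_cells_per_line A r L I C \<and>
     (\<exists>\<epsilon>\<in>{0..\<delta>}. \<forall>i\<in>I.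
        real (card {l\<in>L. \<exists>p\<in>C i. p \<in> l}) \<le> A * (N powr (1 + \<epsilon>) / real r))"

definition point_weighted_cell_decomposition ::
    "real \<Rightarrow> real \<Rightarrow> real \<Rightarrow> nat \<Rightarrow> (real^2) set set \<Rightarrow> (real^2) set \<Rightarrow> nat set \<Rightarrow>
      (nat \<Rightarrow> (real^2) set) \<Rightarrow> bool" where
  "point_weighted_cell_decomposition A \<delta> N r L P I C \<longleftrightarrow>
     cell_partition r P I C \<and> few_cells_per_line A r L I C \<and>
     (\<exists>\<epsilon>\<in>{0..\<delta>}. \<forall>i\<in>I. real (card (C i)) \<le> A * (N powr (1 + \<epsilon>) / (real r)\<^sup>2))"

end

theory Submission
  imports Defs "HOL-Real_Asymp.Real_Asymp"
begin

text \<open>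
  Keep the cells with at most \<open>N\<^sup>1\<^sup>/\<^sup>3\<^sup>+\<close> points.  There are at most \<open>N / m\<close> cells with more than \<open>m\<close>
  points, and each of them meets only \<open>N\<^sup>2\<^sup>/\<^sup>3\<^sup>+\<close> lines, so for \<open>m\<close> slightly above \<open>N\<^sup>1\<^sup>/\<^sup>3\<close> the
  Szemeredi-Trotter theorem, applied in every cell and summed, shows that the discarded cells carry
  less than half of the incidences.  The same theorem bounds the number of kept points from below.

  The Szemeredi-Trotter theorem follows Szekely: the points are the vertices and the pairs of
  consecutive points on a line are the edges of a straight-line drawing, in which two lines account
  for at most one crossing.
\<close>

section \<open>Crossings in straight-line drawings\<close>

definition slope :: "('a \<Rightarrow> real) \<Rightarrow> ('a \<Rightarrow> real) \<Rightarrow> 'a \<times> 'a \<Rightarrow> real" where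
  "slope X Y e = (Y (snd e) - Y (fst e)) / (X (snd e) - X (fst e))"

definition height :: "('a \<Rightarrow> real) \<Rightarrow> ('a \<Rightarrow> real) \<Rightarrow> 'a \<times> 'a \<Rightarrow> real \<Rightarrow> real" where
  "height X Y e x = Y (fst e) + slope X Y e * (x - X (fst e))"

text \<open>Between its ends an edge is the graph of an affine function, so a crossing is a common
  interior abscissa with equal heights. Overlapping edges count as crossing, and the relation is
  symmetric in the two edges.\<close>

definition crosses :: "('a \<Rightarrow> real) \<Rightarrow> ('a \<Rightarrow> real) \<Rightarrow> 'a \<times> 'a \<Rightarrow> 'a \<times> 'a \<Rightarrow> bool" where
  "crosses X Y e f \<longleftrightarrow> e \<noteq> f \<and>
     (\<exists>x. X (fst e) < x \<and> x < X (snd e) \<and> X (fst f) < x \<and> x < X (snd f) \<and>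
          height X Y e x = height X Y f x)"

lemma height_fst [simp]: "height X Y (p, q) (X p) = Y p"
  by (simp add: height_def)

lemma height_snd: "X p < X q \<Longrightarrow> height X Y (p, q) (X q) = Y q"
  by (simp add: height_def slope_def)

lemma height_from_snd:
  "X p < X q \<Longrightarrow> height X Y (p, q) x = Y q - slope X Y (p, q) * (X q - x)"
  by (simp add: height_def slope_def divide_simps) (simp add: algebra_simps)

text \<open>Intermediate value theorem for the difference of the heights. The strict signs at
  \<open>a\<close> and \<open>b\<close> push the zero into the interior of both edges and also make
  the edges distinct.\<close>

lemma crossesI:
  assumes "a < b" "X (fst e) \<le> a" "b \<le> X (snd e)" "X (fst f) \<le> a" "b \<le> X (snd f)"
    and "height X Y e a < height X Y f a" "height X Y f b < height X Y e b"
  shows "crosses X Y e f"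
proof -
  let ?d = "\<lambda>x. height X Y e x - height X Y f x"
  have "continuous_on {a..b} ?d"
    unfolding height_def by (intro continuous_intros)
  then obtain x where x: "a \<le> x" "x \<le> b" "?d x = 0"
    using IVT'[of ?d a 0 b] assms by auto
  have "x \<noteq> a" "x \<noteq> b" using x assms by auto
  then have "X (fst e) < x \<and> x < X (snd e) \<and> X (fst f) < x \<and> x < X (snd f)"
    using x assms by linarith
  moreover have "e \<noteq> f" using assms by auto
  ultimately show ?thesis unfolding crosses_def using x(3) by auto
qed

text \<open>The coordinates are functions on an abstract vertex type. \<open>edge_less\<close>
  directs edges from left to right, which excludes loops and vertical edges;
  \<open>vertex_off_edge\<close> keeps vertices out of the interior of edges.\<close>

locale geometric_graph =
  fixes X Y :: "'a \<Rightarrow> real" and V :: "'a set" and E :: "('a \<times> 'a) set"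
  assumes finite_V: "finite V"
    and edge_in_V: "(p, q) \<in> E \<Longrightarrow> p \<in> V \<and> q \<in> V"
    and inj_X: "inj_on X V"
    and edge_less: "(p, q) \<in> E \<Longrightarrow> X p < X q"
    and vertex_off_edge: "\<lbrakk>(p, q) \<in> E; w \<in> V; X p < X w; X w < X q\<rbrakk>
          \<Longrightarrow> height X Y (p, q) (X w) \<noteq> Y w"
begin

lemma finite_E: "finite E"
  by (rule finite_subset[of _ "V \<times> V"]) (use finite_V edge_in_V in auto)

text \<open>Equal slopes would make the shorter edge a part of the longer one, and its far end would
  be a vertex inside an edge.\<close>

lemma slope_inj_fst:
  assumes "(p, q) \<in> E" "(p, q') \<in> E" "slope X Y (p, q) = slope X Y (p, q')"
  shows "q = q'"
proof (rule ccontr)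
  assume "q \<noteq> q'"
  have eq: "height X Y (p, q) x = height X Y (p, q') x" for x
    using assms(3) by (simp add: height_def)
  have "X q \<noteq> X q'" using \<open>q \<noteq> q'\<close> inj_X assms edge_in_V by (meson inj_onD)
  then consider "X q < X q'" | "X q' < X q" by linarith
  then show False
  proof cases
    case 1
    then show False
      using vertex_off_edge[OF assms(2), of q] eq[of "X q"] edge_in_V[OF assms(1)]
        edge_less[OF assms(1)] height_snd by metis
  next
    case 2
    then show False
      using vertex_off_edge[OF assms(1), of q'] eq[of "X q'"] edge_in_V[OF assms(2)]
        edge_less[OF assms(2)] height_snd by metis
  qed
qed

lemma slope_inj_snd:
  assumes "(p, q) \<in> E" "(p', q) \<in> E" "slope X Y (p, q) = slope X Y (p', q)"
  shows "p = p'"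
proof (rule ccontr)
  assume "p \<noteq> p'"
  have eq: "height X Y (p, q) x = height X Y (p', q) x" for x
    using assms edge_less by (simp add: height_from_snd)
  have "X p \<noteq> X p'" using \<open>p \<noteq> p'\<close> inj_X assms edge_in_V by (meson inj_onD)
  then consider "X p < X p'" | "X p' < X p" by linarith
  then show False
  proof cases
    case 1
    then show False
      using vertex_off_edge[OF assms(1), of p'] eq[of "X p'"] edge_in_V[OF assms(2)]
        edge_less[OF assms(2)] height_fst by metis
  next
    case 2
    then show False
      using vertex_off_edge[OF assms(2), of p] eq[of "X p"] edge_in_V[OF assms(1)]
        edge_less[OF assms(1)] height_fst by metis
  qed
qed

section \<open>Charging the edges of a crossing-free drawing to vertices\<close>

definition lies_above :: "'a \<Rightarrow> 'a \<times> 'a \<Rightarrow> bool" where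
  "lies_above w e \<longleftrightarrow> X (fst e) < X w \<and> X w < X (snd e) \<and> height X Y e (X w) < Y w"

text \<open>For an edge \<open>e\<close> of the graph: a vertical ray going down from
  \<open>w\<close> meets \<open>e\<close> before the interior of any other edge that is strictly
  lower there.\<close>

definition sees :: "'a \<Rightarrow> 'a \<times> 'a \<Rightarrow> bool" where
  "sees w e \<longleftrightarrow> lies_above w e \<and>
     (\<forall>g\<in>E. lies_above w g \<longrightarrow> height X Y g (X w) \<le> height X Y e (X w))"

text \<open>Both edges have \<open>X w\<close> strictly inside their span and the same maximal
  height there, so distinct ones would cross.\<close>

lemma sees_unique:
  assumes "\<And>e f. \<lbrakk>e \<in> E; f \<in> E\<rbrakk> \<Longrightarrow> \<not> crosses X Y e f"
    and "e \<in> E" "f \<in> E" "sees w e" "sees w f"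
  shows "e = f"
proof (rule ccontr)
  assume "e \<noteq> f"
  have "height X Y e (X w) = height X Y f (X w)"
    using assms unfolding sees_def by (meson order_antisym)
  then have "crosses X Y e f"
    using \<open>e \<noteq> f\<close> assms unfolding crosses_def sees_def lies_above_def by blast
  then show False using assms by blast
qed

text \<open>If \<open>pq\<close> has an edge above it at both ends, then a leftmost vertex of the wedge at \<open>p\<close>
  between \<open>pq\<close> and the next edge above it has \<open>pq\<close> directly below it.\<close>

lemma ex_sees:
  assumes nc: "\<And>e f. \<lbrakk>e \<in> E; f \<in> E\<rbrakk> \<Longrightarrow> \<not> crosses X Y e f"
    and e: "(p, q) \<in> E"
    and f: "(p, f1) \<in> E" "slope X Y (p, q) < slope X Y (p, f1)"
    and g: "(s, q) \<in> E" "slope X Y (s, q) < slope X Y (p, q)"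
  shows "\<exists>w\<in>V. sees w (p, q)"
proof -
  \<comment> \<open>\<open>F\<close> collects the far ends of the edges that leave \<open>p\<close>
    above \<open>pq\<close>. Taking \<open>q'\<close> of least slope ensures that no edge starting
    at \<open>p\<close> runs strictly inside the wedge between \<open>pq\<close> and
    \<open>pq'\<close>.\<close>
  define F where "F = {q'. (p, q') \<in> E \<and> slope X Y (p, q) < slope X Y (p, q')}"
  have "finite F"
    by (rule finite_subset[of _ V]) (use finite_V edge_in_V in \<open>auto simp: F_def\<close>)
  moreover have "f1 \<in> F" using f by (simp add: F_def)
  ultimately obtain q' where q': "q' \<in> F"
    and q'min: "\<And>u. u \<in> F \<Longrightarrow> slope X Y (p, q') \<le> slope X Y (p, u)"
    using obtains_MIN[of F "\<lambda>u. slope X Y (p, u)"] by (metis Min_le empty_iff finite_imageI imageI)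
  have q'E: "(p, q') \<in> E" and q's: "slope X Y (p, q) < slope X Y (p, q')"
    using q' by (auto simp: F_def)
  let ?e = "height X Y (p, q)" and ?f = "height X Y (p, q')" and ?g = "height X Y (s, q)"
  have pq: "X p < X q" and pq': "X p < X q'" and sq: "X s < X q"
    using edge_less e q'E g by auto
  have ef: "?e x < ?f x" if "X p < x" for x
    using that q's by (simp add: height_def)
  have eg: "?e x < ?g x" if "x < X q" for x
    using that g(2) pq sq by (simp add: height_from_snd)
  \<comment> \<open>The vertices of the wedge over the common span. Points on \<open>pq\<close> are
    excluded and points on \<open>pq'\<close> are allowed, so that \<open>q'\<close> itself belongs
    to \<open>W\<close> whenever it lies left of \<open>q\<close>.\<close>
  define W where "W = {w\<in>V. X p < X w \<and> X w < X q \<and> X w \<le> X q' \<and> ?e (X w) < Y w \<and> Y w \<le> ?f (X w)}"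
  show ?thesis
  proof (cases "W = {}")
    case True
    have "q' \<notin> W" using True by simp
    then have "X q \<le> X q'"
      using ef[OF pq'] pq' height_snd[of X p q' Y, OF pq'] edge_in_V[OF q'E] by (auto simp: W_def)
    have fq: "?g (X q) < ?f (X q)"
      using ef[OF pq] height_snd[of X p q Y, OF pq] height_snd[of X s q Y, OF sq] by simp
    \<comment> \<open>At \<open>X q\<close> the edge \<open>sq\<close> is below \<open>pq'\<close>.
      At the larger of \<open>X p\<close> and \<open>X s\<close> it is above \<open>pq'\<close>:
      either it passes above \<open>p\<close>, or it starts at \<open>s\<close>, which is above
      \<open>pq\<close> and not in the empty wedge.\<close>
    have "crosses X Y (p, q') (s, q)"
    proof (cases "X s \<le> X p")
      case True
      show ?thesis
        by (rule crossesI[of "X p" "X q"]) (use True pq fq eg[OF pq] \<open>X q \<le> X q'\<close> in auto)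
    next
      case False
      have "s \<notin> W" using \<open>W = {}\<close> by simp
      then have "?f (X s) < Y s"
        using False sq eg[OF sq] edge_in_V[OF g(1)] \<open>X q \<le> X q'\<close> by (auto simp: W_def)
      then show ?thesis
        by (intro crossesI[of "X s" "X q"]) (use False sq fq \<open>X q \<le> X q'\<close> in auto)
    qed
    then show ?thesis using nc q'E g(1) by blast
  next
    case False
    have "finite W" using finite_V by (auto simp: W_def)
    then obtain w where w: "w \<in> W" and wmin: "\<And>u. u \<in> W \<Longrightarrow> X w \<le> X u"
      using False obtains_MIN[of W X] by (metis Min_le finite_imageI imageI)
    have wV: "w \<in> V" and w1: "X p < X w" "X w < X q" "X w \<le> X q'" "?e (X w) < Y w" "Y w \<le> ?f (X w)"
      using w by (auto simp: W_def)
    \<comment> \<open>Suppose \<open>h\<close> passes strictly between \<open>pq\<close> and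
      \<open>w\<close>, and follow it to its left end \<open>a\<close>. If \<open>a = p\<close>, the
      choice of \<open>q'\<close> is violated; if \<open>a\<close> is left of \<open>p\<close>, then
      \<open>h\<close> crosses \<open>pq\<close> or \<open>pq'\<close>; if \<open>a\<close> is right
      of \<open>p\<close>, then \<open>a\<close> is a vertex of the wedge to the left of
      \<open>w\<close>.\<close>
    have "height X Y h (X w) \<le> ?e (X w)" if h: "h \<in> E" "lies_above w h" for h
    proof (rule ccontr)
      obtain a b where ab: "h = (a, b)" by (cases h)
      let ?h = "height X Y (a, b)"
      assume "\<not> ?thesis"
      then have eh: "?e (X w) < ?h (X w)" by (simp add: ab)
      have hw: "X a < X w" "X w < X b" "?h (X w) < Y w" using h by (auto simp: lies_above_def ab)
      have hf: "?h (X w) < ?f (X w)" using hw w1 by linarith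
      have hE: "(a, b) \<in> E" using h ab by simp
      have aV: "a \<in> V" and pV: "p \<in> V" using edge_in_V hE e by auto
      consider "a = p" | "X a < X p" | "X p < X a"
        using inj_X aV pV by (meson inj_onD linorder_less_linear)
      then show False
      proof cases
        case 1
        then have "slope X Y (p, q) < slope X Y (p, b)" "slope X Y (p, b) < slope X Y (p, q')"
          using eh hf w1 by (simp_all add: height_def)
        then show False using q'min[of b] hE 1 by (auto simp: F_def)
      next
        case 2
        have "?h (X p) \<noteq> Y p" using vertex_off_edge[OF hE pV] 2 w1 hw by simp
        then consider "?h (X p) < Y p" | "Y p < ?h (X p)" by linarith
        then have "crosses X Y (a, b) (p, q) \<or> crosses X Y (p, q') (a, b)"
        proof cases
          case i: 1
          have "crosses X Y (a, b) (p, q)"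
            by (rule crossesI[of "X p" "X w"]) (use i 2 w1 hw eh in auto)
          then show ?thesis ..
        next
          case i: 2
          have "crosses X Y (p, q') (a, b)"
            by (rule crossesI[of "X p" "X w"]) (use i 2 w1 hw hf in auto)
          then show ?thesis ..
        qed
        then show False using nc hE e q'E by blast
      next
        case 3
        have "\<not> Y a < ?e (X a)"
        proof
          assume "Y a < ?e (X a)"
          then have "crosses X Y (a, b) (p, q)"
            by (intro crossesI[of "X a" "X w"]) (use 3 w1 hw eh in auto)
          then show False using nc hE e by blast
        qed
        moreover have "?e (X a) \<noteq> Y a" using vertex_off_edge[OF e aV] 3 hw w1 by simp
        moreover have "\<not> ?f (X a) < Y a"
        proof
          assume "?f (X a) < Y a"
          then have "crosses X Y (p, q') (a, b)"
            by (intro crossesI[of "X a" "X w"]) (use 3 w1 hw hf in auto)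
          then show False using nc hE q'E by blast
        qed
        ultimately have "a \<in> W" using 3 hw w1 aV by (auto simp: W_def)
        then show False using wmin[of a] hw by simp
      qed
    qed
    then have "sees w (p, q)" using w1 by (auto simp: sees_def lies_above_def)
    then show ?thesis using wV by blast
  qed
qed

text \<open>Each vertex is charged by the highest edge to its right, the highest edge to its left and
  the edge directly below it.\<close>

lemma card_edges_le_if_no_crossing:
  assumes nc: "\<And>e f. \<lbrakk>e \<in> E; f \<in> E\<rbrakk> \<Longrightarrow> \<not> crosses X Y e f"
  shows "card E \<le> 3 * card V"
proof -
  define E1 where "E1 = {e\<in>E. \<forall>f\<in>E. fst f = fst e \<longrightarrow> slope X Y f \<le> slope X Y e}"
  \<comment> \<open>At a common right end the edge of smallest slope is the highest one, hence the
    inequality opposite to that of \<open>E1\<close>.\<close>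
  define E2 where "E2 = {e\<in>E. \<forall>f\<in>E. snd f = snd e \<longrightarrow> slope X Y e \<le> slope X Y f}"
  define E3 where "E3 = {e\<in>E. \<exists>w\<in>V. sees w e}"
  have "E \<subseteq> E1 \<union> E2 \<union> E3"
  proof
    fix e assume "e \<in> E"
    obtain p q where "e = (p, q)" by (cases e)
    show "e \<in> E1 \<union> E2 \<union> E3"
    proof (rule ccontr)
      assume n: "e \<notin> E1 \<union> E2 \<union> E3"
      obtain f1 where "(p, f1) \<in> E" "slope X Y (p, q) < slope X Y (p, f1)"
        using n \<open>e \<in> E\<close> \<open>e = (p, q)\<close> by (force simp: E1_def)
      moreover obtain s where "(s, q) \<in> E" "slope X Y (s, q) < slope X Y (p, q)"
        using n \<open>e \<in> E\<close> \<open>e = (p, q)\<close> by (force simp: E2_def)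
      ultimately show False
        using ex_sees[OF nc, of p q f1 s] n \<open>e \<in> E\<close> \<open>e = (p, q)\<close> by (simp add: E3_def)
    qed
  qed
  moreover have "card E1 \<le> card V"
  proof (rule card_inj_on_le[of fst])
    show "inj_on fst E1"
    proof (rule inj_onI)
      fix e f assume "e \<in> E1" "f \<in> E1" and eq: "fst e = fst f"
      then have "e \<in> E" "f \<in> E" "slope X Y e = slope X Y f"
        by (auto simp: E1_def intro: order_antisym)
      then show "e = f"
        using slope_inj_fst eq by (metis prod.collapse)
    qed
  qed (use edge_in_V finite_V in \<open>auto simp: E1_def\<close>)
  moreover have "card E2 \<le> card V"
  proof (rule card_inj_on_le[of snd])
    show "inj_on snd E2"
    proof (rule inj_onI)
      fix e f assume "e \<in> E2" "f \<in> E2" and eq: "snd e = snd f"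
      then have "e \<in> E" "f \<in> E" "slope X Y e = slope X Y f"
        by (auto simp: E2_def intro: order_antisym)
      then show "e = f"
        using slope_inj_snd eq by (metis prod.collapse)
    qed
  qed (use edge_in_V finite_V in \<open>auto simp: E2_def\<close>)
  moreover have "card E3 \<le> card V"
  proof -
    obtain w where w: "\<And>e. e \<in> E3 \<Longrightarrow> w e \<in> V \<and> sees (w e) e"
      using bchoice[of E3 "\<lambda>e w. w \<in> V \<and> sees w e"] by (auto simp: E3_def)
    have "inj_on w E3"
    proof (rule inj_onI)
      fix e f assume "e \<in> E3" "f \<in> E3" "w e = w f"
      then show "e = f"
        using sees_unique[OF nc, of e f "w e"] w[of e] w[of f] by (simp add: E3_def)
    qed
    then show ?thesis using w finite_V by (intro card_inj_on_le[of w]) auto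
  qed
  moreover have "card E \<le> card (E1 \<union> E2 \<union> E3)"
    using finite_E calculation(1) by (intro card_mono) (auto simp: E1_def E2_def E3_def)
  moreover have "card (E1 \<union> E2 \<union> E3) \<le> card E1 + card E2 + card E3"
    by (meson add_right_mono card_Un_le order_trans)
  ultimately show ?thesis by linarith
qed

section \<open>From crossing-free drawings to drawings with crossings\<close>

definition crossings :: "(('a \<times> 'a) \<times> ('a \<times> 'a)) set" where
  "crossings = {(e, f). e \<in> E \<and> f \<in> E \<and> crosses X Y e f}"

lemma finite_crossings: "finite crossings"
  by (rule finite_subset[of _ "E \<times> E"]) (use finite_E in \<open>auto simp: crossings_def\<close>)

lemma subgraph:
  assumes "S \<subseteq> V" "F \<subseteq> E" "F \<subseteq> S \<times> S"
  shows "geometric_graph X Y S F"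
proof
  show "finite S" using assms finite_V finite_subset by blast
  show "inj_on X S" using assms inj_X inj_on_subset by blast
qed (use assms edge_less vertex_off_edge in blast)+

text \<open>Since \<open>crossings\<close> consists of ordered pairs and is symmetric, its first
  components are all the edges that cross another one. Deleting them costs at most one edge per pair
  and leaves a crossing-free drawing.\<close>

lemma card_edges_le: "card E \<le> 3 * card V + card crossings"
proof -
  define F where "F = E - fst ` crossings"
  interpret F: geometric_graph X Y V F
    by (rule subgraph) (use edge_in_V in \<open>auto simp: F_def\<close>)
  have "card F \<le> 3 * card V"
  proof (rule F.card_edges_le_if_no_crossing)
    fix e f assume "e \<in> F" "f \<in> F"
    then show "\<not> crosses X Y e f" by (force simp: F_def crossings_def)
  qed
  moreover have "card E \<le> card F + card (fst ` crossings)"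
    using finite_E finite_crossings
    by (metis F_def add.commute card_Diff_subset_Int diff_card_le_card_Diff finite_imageI le_diff_conv)
  moreover have "card (fst ` crossings) \<le> card crossings"
    using finite_crossings by (rule card_image_le)
  ultimately show ?thesis by linarith
qed

text \<open>Edges with a common left or right end have different slopes and meet only there. Four
  distinct ends are what makes a crossing survive in a colour class with probability
  \<open>1 / k ^ 4\<close>.\<close>

lemma crossing_edges_disjoint:
  assumes "((a, b), (c, d)) \<in> crossings"
  shows "card {a, b, c, d} = 4"
proof -
  have E: "(a, b) \<in> E" "(c, d) \<in> E" "(a, b) \<noteq> (c, d)" and "crosses X Y (a, b) (c, d)"
    using assms by (auto simp: crossings_def crosses_def)
  then obtain x where x: "X a < x" "x < X b" "X c < x" "x < X d"
      "height X Y (a, b) x = height X Y (c, d) x"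
    by (auto simp: crosses_def)
  have "a \<noteq> c"
  proof
    assume "a = c"
    then have "slope X Y (a, b) = slope X Y (c, d)" using x by (simp add: height_def)
    then show False using slope_inj_fst E \<open>a = c\<close> by blast
  qed
  moreover have "b \<noteq> d"
  proof
    assume "b = d"
    then have "slope X Y (a, b) = slope X Y (c, d)"
      using x E edge_less by (simp add: height_from_snd)
    then show False using slope_inj_snd E \<open>b = d\<close> by blast
  qed
  moreover have "a \<noteq> b" "c \<noteq> d" "a \<noteq> d" "b \<noteq> c" using x by auto
  ultimately show ?thesis by auto
qed

end

section \<open>Counting colourings\<close>

lemma sum_card_swap:
  assumes "finite A" "finite B"
  shows "(\<Sum>a\<in>A. card {b\<in>B. Q a b}) = (\<Sum>b\<in>B. card {a\<in>A. Q a b})"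
proof -
  have card_eq: "card {x\<in>S. R x} = (\<Sum>x\<in>S. if R x then 1 else 0)" if "finite S" for S :: "'c set" and R
    using that by (simp add: sum.If_cases Int_def)
  show ?thesis
    using assms by (simp only: card_eq) (rule sum.swap)
qed

text \<open>A uniform colouring with \<open>k\<close> colours is 0 on all of \<open>T\<close> with
  probability \<open>1 / k ^ card T\<close>; clearing denominators keeps the statement in the
  natural numbers.\<close>

lemma card_colourings_vanishing_on:
  fixes k :: nat
  assumes "finite V" "T \<subseteq> V" "k \<ge> 1"
  shows "card {f \<in> V \<rightarrow>\<^sub>E {..<k}. \<forall>v\<in>T. f v = 0} * k ^ card T = k ^ card V"
proof -
  have "{f \<in> V \<rightarrow>\<^sub>E {..<k}. \<forall>v\<in>T. f v = 0} = (\<Pi>\<^sub>E v\<in>V. if v \<in> T then {0} else {..<k})"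
  proof (intro subset_antisym subsetI)
    fix f assume "f \<in> (\<Pi>\<^sub>E v\<in>V. if v \<in> T then {0} else {..<k})"
    then have "f v \<in> (if v \<in> T then {0} else {..<k})" if "v \<in> V" for v
      using that by (rule PiE_mem)
    then have "f v < k" "v \<in> T \<longrightarrow> f v = 0" if "v \<in> V" for v
      using that assms(3) by (fastforce split: if_splits)+
    then show "f \<in> {f \<in> V \<rightarrow>\<^sub>E {..<k}. \<forall>v\<in>T. f v = 0}"
      using \<open>f \<in> _\<close> assms(2) by (auto simp: PiE_iff)
  qed (auto simp: PiE_iff)
  then have "card {f \<in> V \<rightarrow>\<^sub>E {..<k}. \<forall>v\<in>T. f v = 0} =
      (\<Prod>v\<in>V. card (if v \<in> T then {0} else {..<k}))"
    using assms(1) by (simp only: card_PiE)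
  also have "\<dots> = (\<Prod>v\<in>V. if v \<in> T then 1 else k)"
    by (rule prod.cong) auto
  also have "\<dots> = k ^ card (V - T)"
    using assms(1) by (simp add: prod.If_cases Diff_eq)
  finally have "card {f \<in> V \<rightarrow>\<^sub>E {..<k}. \<forall>v\<in>T. f v = 0} = k ^ card (V - T)" .
  moreover have "card (V - T) + card T = card V"
    using assms by (metis card_Diff_subset card_mono finite_subset le_add_diff_inverse2)
  ultimately show ?thesis
    by (simp flip: power_add)
qed

text \<open>Linearity of expectation for objects \<open>a\<close> that survive exactly when their
  support \<open>T a\<close> has colour 0.\<close>

lemma sum_card_vanishing_on:
  fixes k :: nat
  assumes "finite V" "finite A" "k \<ge> 1"
    and "\<And>a. a \<in> A \<Longrightarrow> T a \<subseteq> V \<and> card (T a) = j"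
  shows "(\<Sum>f\<in>V \<rightarrow>\<^sub>E {..<k}. card {a\<in>A. \<forall>v\<in>T a. f v = 0}) * k ^ j = card A * k ^ card V"
proof -
  have "(\<Sum>f\<in>V \<rightarrow>\<^sub>E {..<k}. card {a\<in>A. \<forall>v\<in>T a. f v = 0}) =
      (\<Sum>a\<in>A. card {f \<in> V \<rightarrow>\<^sub>E {..<k}. \<forall>v\<in>T a. f v = 0})"
    using assms by (intro sum_card_swap finite_PiE) auto
  moreover have "card {f \<in> V \<rightarrow>\<^sub>E {..<k}. \<forall>v\<in>T a. f v = 0} * k ^ j = k ^ card V" if "a \<in> A" for a
    using card_colourings_vanishing_on[of V "T a" k] assms that by auto
  ultimately show ?thesis
    by (simp add: sum_distrib_right)
qed

context geometric_graph
begin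

text \<open>Average \<open>card_edges_le\<close> over the colour class of a random colouring.\<close>

lemma crossing_lemma:
  assumes "k \<ge> 1"
  shows "k\<^sup>2 * card E \<le> 3 * card V * k ^ 3 + card crossings"
proof -
  define \<Phi> where "\<Phi> = (V \<rightarrow>\<^sub>E {..<k})"
  define TE :: "'a \<times> 'a \<Rightarrow> 'a set" where "TE e = {fst e, snd e}" for e
  define TX :: "('a \<times> 'a) \<times> ('a \<times> 'a) \<Rightarrow> 'a set" where "TX c = TE (fst c) \<union> TE (snd c)" for c
  \<comment> \<open>Up to the factor \<open>k ^ card V\<close>, the three sums are the expected
    numbers of vertices, edges and crossings in colour class 0. The singleton \<open>{v}\<close>
    gives vertices the same shape as the other supports.\<close>
  define SV where "SV = (\<Sum>f\<in>\<Phi>. card {v\<in>V. \<forall>u\<in>{v}. f u = 0})"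
  define SE where "SE = (\<Sum>f\<in>\<Phi>. card {e\<in>E. \<forall>u\<in>TE e. f u = 0})"
  define SX where "SX = (\<Sum>f\<in>\<Phi>. card {c\<in>crossings. \<forall>u\<in>TX c. f u = 0})"
  have "card {e\<in>E. \<forall>u\<in>TE e. f u = 0} \<le>
      3 * card {v\<in>V. \<forall>u\<in>{v}. f u = 0} + card {c\<in>crossings. \<forall>u\<in>TX c. f u = 0}" for f :: "'a \<Rightarrow> nat"
  proof -
    interpret S: geometric_graph X Y "{v\<in>V. \<forall>u\<in>{v}. f u = 0}" "{e\<in>E. \<forall>u\<in>TE e. f u = 0}"
      by (rule subgraph) (use edge_in_V in \<open>auto simp: TE_def\<close>)
    have "S.crossings = {c\<in>crossings. \<forall>u\<in>TX c. f u = 0}"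
        by (rule set_eqI) (simp only: S.crossings_def crossings_def TX_def mem_Collect_eq case_prod_beta ball_Un, blast)
    then show ?thesis using S.card_edges_le by (simp only:)
  qed
  then have "SE \<le> (\<Sum>f\<in>\<Phi>. 3 * card {v\<in>V. \<forall>u\<in>{v}. f u = 0} +
      card {c\<in>crossings. \<forall>u\<in>TX c. f u = 0})"
    unfolding SE_def by (rule sum_mono)
  then have le: "SE \<le> 3 * SV + SX"
    unfolding SV_def SX_def by (simp only: sum.distrib sum_distrib_left)
  have SV: "SV * k ^ 1 = card V * k ^ card V"
    unfolding SV_def \<Phi>_def
    by (rule sum_card_vanishing_on[OF finite_V finite_V assms]) auto
  have TE: "TE e \<subseteq> V \<and> card (TE e) = 2" if "e \<in> E" for e
  proof -
    have "fst e \<in> V" "snd e \<in> V" "fst e \<noteq> snd e"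
      using that edge_in_V[of "fst e" "snd e"] edge_less[of "fst e" "snd e"] by auto
    then show ?thesis by (auto simp: TE_def)
  qed
  have SE: "SE * k ^ 2 = card E * k ^ card V"
    unfolding SE_def \<Phi>_def
    by (rule sum_card_vanishing_on[OF finite_V finite_E assms TE])
  have TX: "TX c \<subseteq> V \<and> card (TX c) = 4" if "c \<in> crossings" for c
  proof -
    obtain p q u v where c: "c = ((p, q), (u, v))" by (metis prod.collapse)
    then have "TX c = {p, q, u, v}" by (auto simp: TX_def TE_def)
    moreover have "card {p, q, u, v} = 4" "(p, q) \<in> E" "(u, v) \<in> E"
      using crossing_edges_disjoint that c by (auto simp: crossings_def)
    ultimately show ?thesis
      using edge_in_V by auto
  qed
  have SX: "SX * k ^ 4 = card crossings * k ^ card V"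
    unfolding SX_def \<Phi>_def
    by (rule sum_card_vanishing_on[OF finite_V finite_crossings assms TX])
  \<comment> \<open>Multiplying by \<open>k ^ 4\<close> clears all the probabilities
    \<open>1 / k\<close>, \<open>1 / k ^ 2\<close> and \<open>1 / k ^ 4\<close> at once.\<close>
  have "k ^ card V * (k\<^sup>2 * card E) = SE * k ^ 2 * k\<^sup>2"
    unfolding SE by (simp only: ac_simps)
  also have "\<dots> = SE * k ^ 4"
    by (simp flip: power_add)
  also have "\<dots> \<le> (3 * SV + SX) * k ^ 4"
    using le by (rule mult_le_mono1)
  also have "\<dots> = 3 * (SV * k ^ 1) * k ^ 3 + SX * k ^ 4"
    by (simp add: add_mult_distrib power_numeral_reduce mult.assoc)
  also have "\<dots> = k ^ card V * (3 * card V * k ^ 3 + card crossings)"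
    unfolding SV SX by (simp only: distrib_left ac_simps)
  finally have "k ^ card V * (k\<^sup>2 * card E) \<le> k ^ card V * (3 * card V * k ^ 3 + card crossings)" .
  moreover have "0 < k ^ card V" using assms by simp
  ultimately show ?thesis by (simp only: mult_le_cancel1)
qed

end

section \<open>Incidences between points and lines\<close>

text \<open>The abscissa of the drawing. A suitable \<open>t\<close> plays the part of a rotation
  that moves the points to distinct abscissae.\<close>

definition shear :: "real \<Rightarrow> real^2 \<Rightarrow> real" where
  "shear t v = v $ 1 + t * v $ 2"

text \<open>Two distinct points collide for at most one value of \<open>t\<close>, so finitely many
  values are to be avoided.\<close>

lemma ex_inj_on_shear:
  assumes "finite P"
  shows "\<exists>t. inj_on (shear t) P"
proof -
  define B where "B = (\<lambda>(p, q). (q $ 1 - p $ 1) / (p $ 2 - q $ 2)) ` (P \<times> P)"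
  have "finite B" using assms by (simp add: B_def)
  then obtain t where t: "t \<notin> B" by (meson ex_new_if_finite infinite_UNIV_char_0)
  have "inj_on (shear t) P"
  proof (rule inj_onI, rule ccontr)
    fix p q assume pq: "p \<in> P" "q \<in> P" "shear t p = shear t q" "p \<noteq> q"
    then have "p $ 2 \<noteq> q $ 2" by (auto simp: shear_def vec_eq_iff forall_2)
    then have "t = (q $ 1 - p $ 1) / (p $ 2 - q $ 2)"
      using pq(3) by (simp add: shear_def field_simps)
    then show False using t pq by (auto simp: B_def)
  qed
  then show ?thesis by blast
qed

lemma is_line_eq:
  assumes "is_line l" "is_line l'" "p \<noteq> q" "p \<in> l" "q \<in> l" "p \<in> l'" "q \<in> l'"
  shows "l = l'"
proof -
  have "affine hull {p, q} = m" if "is_line m" "p \<in> m" "q \<in> m" for m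
    using that assms(3) by (intro affine_dim_equal) (auto simp: is_line_def hull_minimal)
  then show ?thesis using assms by metis
qed

text \<open>In sheared coordinates the equation says that \<open>w\<close> divides \<open>pq\<close>
  in the ratio \<open>s\<close> in both coordinates; the shear is invertible, so \<open>w\<close> is
  an affine combination of \<open>p\<close> and \<open>q\<close>.\<close>

lemma mem_line_if_height_eq:
  assumes "is_line l" "p \<in> l" "q \<in> l" "shear t p < shear t q"
    and "height (shear t) (\<lambda>v. v $ 2) (p, q) (shear t w) = w $ 2"
  shows "w \<in> l"
proof -
  define s where "s = (shear t w - shear t p) / (shear t q - shear t p)"
  have 2: "w $ 2 = p $ 2 + s * (q $ 2 - p $ 2)"
    using assms(5) by (simp add: height_def slope_def s_def mult.commute)
  have "shear t w = shear t p + s * (shear t q - shear t p)"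
    using assms(4) by (simp add: s_def)
  then have 1: "w $ 1 = p $ 1 + s * (q $ 1 - p $ 1)"
    using 2 by (simp add: shear_def algebra_simps)
  have "w = (1 - s) *\<^sub>R p + s *\<^sub>R q"
    using 1 2 by (simp add: vec_eq_iff forall_2 algebra_simps)
  moreover have "(1 - s) *\<^sub>R p + s *\<^sub>R q \<in> l"
    using assms by (intro mem_affine) (auto simp: is_line_def)
  ultimately show ?thesis by simp
qed

text \<open>All but at most one incidence of each line give an edge to the next point on it, so
  there are at most \<open>card L + card E\<close> incidences. The crossing lemma bounds
  \<open>card E\<close>, with at most one ordered crossing per ordered pair of lines.\<close>

lemma incidence_bound_nat:
  assumes "finite L" "finite P" and lines: "\<forall>l\<in>L. is_line l" and "k \<ge> 1"
  shows "k\<^sup>2 * card (incidences L P) \<le> k\<^sup>2 * card L + 3 * card P * k ^ 3 + (card L)\<^sup>2"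
proof -
  obtain t where inj: "inj_on (shear t) P" using ex_inj_on_shear assms by blast
  define X where "X = shear t"
  define Y where "Y = (\<lambda>v :: real^2. v $ 2)"
  \<comment> \<open>\<open>con l p q\<close>: \<open>q\<close> is the next point of \<open>P\<close>
    after \<open>p\<close> on \<open>l\<close>. Consecutiveness keeps all vertices out of the
    interior of edges.\<close>
  define con where "con l p q \<longleftrightarrow> p \<in> P \<and> q \<in> P \<and> p \<in> l \<and> q \<in> l \<and> X p < X q \<and>
      (\<forall>w\<in>P. w \<in> l \<longrightarrow> \<not> (X p < X w \<and> X w < X q))" for l p q
  define E where "E = {(p, q). \<exists>l\<in>L. con l p q}"
  have con_mem: "w \<in> l" if "con l p q" "l \<in> L" "height X Y (p, q) (X w) = Y w" for l p q w
    using that lines mem_line_if_height_eq[of l p q t w] by (auto simp: con_def X_def Y_def)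
  interpret geometric_graph X Y P E
  proof
    show "inj_on X P" using inj by (simp add: X_def)
    show "height X Y (p, q) (X w) \<noteq> Y w"
      if pq: "(p, q) \<in> E" and w: "w \<in> P" "X p < X w" "X w < X q" for p q w
    proof
      assume eq: "height X Y (p, q) (X w) = Y w"
      obtain l where l: "l \<in> L" "con l p q" using pq by (auto simp: E_def)
      then have "w \<in> l" using con_mem eq by blast
      then show False using l w unfolding con_def by blast
    qed
    show "finite P" by fact
    show "X p < X q" "p \<in> P \<and> q \<in> P" if "(p, q) \<in> E" for p q
      using that by (auto simp: E_def con_def)
  qed
  \<comment> \<open>The gaps between consecutive points of one line are disjoint, so an abscissa
    inside a gap determines its ends.\<close>
  have con_unique: "p = p' \<and> q = q'"
    if "con l p q" "con l p' q'" "X p < x" "x < X q" "X p' < x" "x < X q'" for l p q p' q' x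
  proof -
    have mem: "p \<in> P" "p' \<in> P" "q \<in> P" "q' \<in> P" "p \<in> l" "p' \<in> l" "q \<in> l" "q' \<in> l"
      using that by (auto simp: con_def)
    have gap: "\<not> (X p < X w \<and> X w < X q)" "\<not> (X p' < X w \<and> X w < X q')"
      if "w \<in> P" "w \<in> l" for w
      using that \<open>con l p q\<close> \<open>con l p' q'\<close> by (auto simp: con_def)
    have "X p = X p'" "X q = X q'"
      using that(3-6) gap(1)[OF mem(2,6)] gap(2)[OF mem(1,5)] gap(1)[OF mem(4,8)] gap(2)[OF mem(3,7)]
      by linarith+
    then show ?thesis using mem inj_X by (meson inj_onD)
  qed
  have "\<forall>e\<in>E. \<exists>l. l \<in> L \<and> con l (fst e) (snd e)" by (auto simp: E_def)
  then obtain ln where ln: "\<And>e. e \<in> E \<Longrightarrow> ln e \<in> L \<and> con (ln e) (fst e) (snd e)"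
    by metis
  have meet: "\<exists>z. X (fst e) < X z \<and> X z < X (snd e) \<and> X (fst f) < X z \<and> X z < X (snd f) \<and>
      z \<in> ln e \<and> z \<in> ln f \<and> ln e \<noteq> ln f" if c: "(e, f) \<in> crossings" for e f
  proof -
    have ef: "e \<in> E" "f \<in> E" "e \<noteq> f" using c by (auto simp: crossings_def crosses_def)
    obtain x where x: "X (fst e) < x" "x < X (snd e)" "X (fst f) < x" "x < X (snd f)"
        "height X Y e x = height X Y f x"
      using c by (auto simp: crossings_def crosses_def)
    \<comment> \<open>The crossing point, recovered from its sheared abscissa \<open>x\<close> and
      its height.\<close>
    define z :: "real^2" where "z = vector [x - t * height X Y e x, height X Y e x]"
    have z: "X z = x" "Y z = height X Y e x" by (auto simp: z_def X_def Y_def shear_def)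
    have "z \<in> ln e" "z \<in> ln f"
      using con_mem[of "ln e" "fst e" "snd e" z] con_mem[of "ln f" "fst f" "snd f" z] ln ef z x
      by auto
    moreover have "ln e \<noteq> ln f"
    proof
      assume "ln e = ln f"
      then have "fst e = fst f \<and> snd e = snd f"
        using ln[OF ef(1)] ln[OF ef(2)] x by (intro con_unique[of "ln e" _ _ _ _ x]) auto
      then show False using ef by (simp add: prod_eq_iff)
    qed
    ultimately show ?thesis using x z by blast
  qed
  have "card crossings \<le> card (L \<times> L)"
  \<comment> \<open>The two distinct lines determine the crossing point, and the point determines
    the gap, hence the edge, on each line.\<close>
  proof (rule card_inj_on_le[of "map_prod ln ln"])
    show "inj_on (map_prod ln ln) crossings"
    proof (rule inj_onI)
      fix c c' assume cc: "c \<in> crossings" "c' \<in> crossings" "map_prod ln ln c = map_prod ln ln c'"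
      obtain e f e' f' where c: "c = (e, f)" "c' = (e', f')" by (metis prod.collapse)
      have E: "e \<in> E" "f \<in> E" "e' \<in> E" "f' \<in> E" using cc c by (auto simp: crossings_def)
      have eq: "ln e = ln e'" "ln f = ln f'" using cc c by auto
      obtain z where z: "X (fst e) < X z" "X z < X (snd e)" "X (fst f) < X z" "X z < X (snd f)"
          "z \<in> ln e" "z \<in> ln f" "ln e \<noteq> ln f"
        using meet cc c by blast
      obtain z' where z': "X (fst e') < X z'" "X z' < X (snd e')" "X (fst f') < X z'"
          "X z' < X (snd f')" "z' \<in> ln e" "z' \<in> ln f"
        using meet cc c eq by metis
      have "z = z'"
        using is_line_eq[of "ln e" "ln f" z z'] z z' lines ln E by blast
      then have "fst e = fst e' \<and> snd e = snd e'" "fst f = fst f' \<and> snd f = snd f'"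
        using ln[OF E(1)] ln[OF E(2)] ln[OF E(3)] ln[OF E(4)] eq z z'
        by (intro con_unique[of "ln e" _ _ _ _ "X z"] con_unique[of "ln f" _ _ _ _ "X z"]; simp)+
      then show "c = c'" using c by (simp add: prod_eq_iff)
    qed
  qed (use ln assms in \<open>auto simp: crossings_def\<close>)
  then have crossings_le: "card crossings \<le> (card L)\<^sup>2"
    by (simp add: card_cartesian_product power2_eq_square)
  \<comment> \<open>The incidences at the last point of a line, which have no successor.\<close>
  define R where "R = {(l, p) \<in> incidences L P. \<forall>q\<in>P. q \<in> l \<longrightarrow> X q \<le> X p}"
  have "card R \<le> card L"
  proof (rule card_inj_on_le[of fst])
    show "inj_on fst R"
    proof (rule inj_onI)
      fix a b assume ab: "a \<in> R" "b \<in> R" "fst a = fst b"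
      then have "X (snd a) = X (snd b)" "snd a \<in> P" "snd b \<in> P"
        by (force simp: R_def incidences_def intro: order_antisym)+
      then show "a = b" using inj_X ab by (metis inj_onD prod_eq_iff)
    qed
  qed (use assms in \<open>auto simp: R_def incidences_def\<close>)
  moreover have "card (incidences L P - R) \<le> card E"
  proof -
    have "\<exists>q. con (fst a) (snd a) q" if "a \<in> incidences L P - R" for a
    proof -
      obtain l p where a: "a = (l, p)" by (cases a)
      define Q where "Q = {q\<in>P. q \<in> l \<and> X p < X q}"
      have "finite Q" "Q \<noteq> {}" using that assms by (auto simp: Q_def R_def a not_le)
      then obtain q where "q \<in> Q" "\<And>u. u \<in> Q \<Longrightarrow> X q \<le> X u"
        using obtains_MIN[of Q X] by (metis Min_le finite_imageI imageI)
      then have "con l p q"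
        using that by (force simp: con_def Q_def a incidences_def simp flip: not_less)
      then show ?thesis using a by auto
    qed
    then obtain nx where nx: "\<And>a. a \<in> incidences L P - R \<Longrightarrow> con (fst a) (snd a) (nx a)"
      by metis
    \<comment> \<open>The pair of a point and its successor determines the line through both, so
      distinct incidences give distinct edges.\<close>
    show ?thesis
    proof (rule card_inj_on_le[of "\<lambda>a. (snd a, nx a)"])
      show "inj_on (\<lambda>a. (snd a, nx a)) (incidences L P - R)"
      proof (rule inj_onI)
        fix a b assume ab: "a \<in> incidences L P - R" "b \<in> incidences L P - R"
          "(snd a, nx a) = (snd b, nx b)"
        then have "fst a \<in> L" "fst b \<in> L" by (auto simp: incidences_def)
        then have "fst a = fst b"
          using nx[OF ab(1)] nx[OF ab(2)] ab(3) lines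
          by (intro is_line_eq[of "fst a" "fst b" "snd a" "nx a"]) (auto simp: con_def)
        then show "a = b" using ab by (simp add: prod_eq_iff)
      qed
      show "(\<lambda>a. (snd a, nx a)) ` (incidences L P - R) \<subseteq> E"
      proof clarify
        fix l p assume lp: "(l, p) \<in> incidences L P" "(l, p) \<notin> R"
        then have "l \<in> L" by (simp add: incidences_def)
        then show "(snd (l, p), nx (l, p)) \<in> E" using nx[of "(l, p)"] lp by (auto simp: E_def)
      qed
    qed (rule finite_E)
  qed
  moreover have "finite R"
    by (rule finite_subset[of _ "L \<times> P"]) (use assms in \<open>auto simp: R_def incidences_def\<close>)
  then have "card (incidences L P) \<le> card R + card (incidences L P - R)"
    using diff_card_le_card_Diff[of R "incidences L P"] by linarith
  ultimately have "card (incidences L P) \<le> card L + card E" by linarith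
  then have "k\<^sup>2 * card (incidences L P) \<le> k\<^sup>2 * card L + k\<^sup>2 * card E"
    by (metis add_mult_distrib2 mult_le_mono2)
  then show ?thesis
    using crossing_lemma[OF \<open>k \<ge> 1\<close>] crossings_le by linarith
qed

text \<open>The choice \<open>x\<^sup>3 = (card L)\<^sup>2 / card P\<close> gives the usual form of the bound.\<close>

lemma szemeredi_trotter:
  fixes x :: real
  assumes "finite L" "finite P" "\<forall>l\<in>L. is_line l" "x \<ge> 1"
  shows "real (card (incidences L P)) \<le> card L + 6 * card P * x + (card L / x)\<^sup>2"
proof -
  \<comment> \<open>Rounding up costs a factor of at most 2 because \<open>x\<close> is at least 1;
    this turns the coefficient 3 into 6.\<close>
  define k where "k = nat \<lceil>x\<rceil>"
  have k: "x \<le> real k" "real k \<le> 2 * x" "k \<ge> 1"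
    using assms unfolding k_def by linarith+
  have "real (k\<^sup>2 * card (incidences L P)) \<le>
      real (k\<^sup>2 * card L + 3 * card P * k ^ 3 + (card L)\<^sup>2)"
    using incidence_bound_nat[OF assms(1-3) k(3)] of_nat_le_iff by blast
  also have "\<dots> = (real k)\<^sup>2 * (card L + 3 * card P * k + (card L / k)\<^sup>2)"
    using k by (simp add: field_simps power2_eq_square power3_eq_cube)
  finally have "card (incidences L P) \<le> card L + 3 * card P * real k + (card L / k)\<^sup>2"
    using k by (simp add: mult_le_cancel_left)
  moreover have "(card L / k)\<^sup>2 \<le> (card L / x)\<^sup>2"
    using k assms by (intro power_mono divide_left_mono) auto
  moreover have "3 * card P * real k \<le> 3 * card P * (2 * x)"
    using k by (intro mult_left_mono) auto
  ultimately show ?thesis by linarith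
qed

section \<open>Discarding the heavy cells\<close>

text \<open>Szemeredi-Trotter in each cell, against only the lines that meet it and with the same
  \<open>x\<close> everywhere. The terms linear in the cell size add up to at most
  \<open>6 * card P * x\<close>; the others are multiplied by the number of cells, which
  disjointness bounds by \<open>card P / m\<close>.\<close>

lemma cells_incidence_bound:
  fixes x n m :: real
  assumes "finite L" "\<forall>l\<in>L. is_line l" "finite P" "finite H"
    and disj: "disjoint_family_on C H" and sub: "(\<Union>i\<in>H. C i) \<subseteq> P"
    and "x \<ge> 1" "m > 0" "n \<ge> 0"
    and few: "\<And>i. i \<in> H \<Longrightarrow> real (card {l\<in>L. \<exists>p\<in>C i. p \<in> l}) \<le> n"
    and many: "\<And>i. i \<in> H \<Longrightarrow> m \<le> real (card (C i))"
  shows "real (card (incidences L (\<Union>i\<in>H. C i))) \<le> card P / m * (n + (n / x)\<^sup>2) + 6 * card P * x"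
proof -
  have fin: "finite (C i)" if "i \<in> H" for i
    using that sub \<open>finite P\<close> by (meson UN_subset_iff finite_subset)
  have sum_card: "(\<Sum>i\<in>H. real (card (C i))) \<le> card P"
  proof -
    have "(\<Sum>i\<in>H. card (C i)) = card (\<Union>i\<in>H. C i)"
      using fin disj \<open>finite H\<close>
      by (intro card_UN_disjoint[symmetric]) (auto simp: disjoint_family_on_def)
    then show ?thesis using card_mono[OF \<open>finite P\<close> sub] by (simp flip: of_nat_sum)
  qed
  have cell: "real (card (incidences L (C i))) \<le> n + 6 * card (C i) * x + (n / x)\<^sup>2" if i: "i \<in> H" for i
  proof -
    let ?L = "{l\<in>L. \<exists>p\<in>C i. p \<in> l}"
    have "incidences L (C i) = incidences ?L (C i)"
      by (auto simp: incidences_def)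
    then have "real (card (incidences L (C i))) \<le> card ?L + 6 * card (C i) * x + (card ?L / x)\<^sup>2"
      using szemeredi_trotter[of ?L "C i" x] assms fin[OF i] by auto
    moreover have "(card ?L / x)\<^sup>2 \<le> (n / x)\<^sup>2"
      using few[OF i] \<open>x \<ge> 1\<close> by (intro power_mono divide_right_mono) auto
    ultimately show ?thesis using few[OF i] by linarith
  qed
  have "card H * m \<le> (\<Sum>i\<in>H. real (card (C i)))"
    using many by (intro sum_bounded_below)
  then have card_H: "card H \<le> card P / m"
    using sum_card \<open>m > 0\<close> by (simp add: field_simps)
  have "incidences L (\<Union>i\<in>H. C i) = (\<Union>i\<in>H. incidences L (C i))"
    by (auto simp: incidences_def)
  then have "card (incidences L (\<Union>i\<in>H. C i)) \<le> (\<Sum>i\<in>H. card (incidences L (C i)))"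
    using card_UN_le[OF \<open>finite H\<close>] by simp
  then have "real (card (incidences L (\<Union>i\<in>H. C i))) \<le> (\<Sum>i\<in>H. real (card (incidences L (C i))))"
    by (simp flip: of_nat_sum)
  also have "\<dots> \<le> (\<Sum>i\<in>H. (n + (n / x)\<^sup>2) + 6 * x * card (C i))"
    using cell by (intro sum_mono) (simp add: algebra_simps)
  also have "\<dots> = card H * (n + (n / x)\<^sup>2) + 6 * x * (\<Sum>i\<in>H. real (card (C i)))"
    by (simp add: sum.distrib sum_distrib_left)
  also have "\<dots> \<le> card P / m * (n + (n / x)\<^sup>2) + 6 * x * card P"
    using card_H sum_card \<open>n \<ge> 0\<close> \<open>x \<ge> 1\<close> by (intro add_mono mult_right_mono mult_left_mono) auto
  finally show ?thesis by (simp add: algebra_simps)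
qed

section \<open>Choice of the exponents\<close>

lemma powr_minus_mono:
  assumes "N \<ge> (1::real)" "\<exists>\<epsilon>\<in>{0..\<delta>}. N powr (a - \<epsilon>) \<le> y"
  shows "N powr (a - \<delta>) \<le> y"
proof -
  obtain \<epsilon> where "\<epsilon> \<le> \<delta>" "N powr (a - \<epsilon>) \<le> y" using assms by auto
  moreover have "N powr (a - \<delta>) \<le> N powr (a - \<epsilon>)"
    using assms \<open>\<epsilon> \<le> \<delta>\<close> by (intro powr_mono) auto
  ultimately show ?thesis by linarith
qed

text \<open>Against the total of at least \<open>s * N powr \<delta> / A\<close> incidences, where
  \<open>s = N powr (4/3 - 2 * \<delta>)\<close>, the heavy cells contribute only a constant
  multiple of \<open>s\<close>. \<open>N_large\<close> makes this at most half; its summand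
  \<open>8 * A\<close> is reserved for the lower bound on \<open>card P'\<close>.\<close>

lemma light_cells:
  fixes A \<delta> N :: real and r :: nat
  assumes A: "A > 0" and \<delta>: "0 < \<delta>" "\<delta> \<le> 1/100" and N: "N \<ge> 1"
    and N_large: "2 * A * (A\<^sup>2 + A ^ 4 + 6) + 8 * A \<le> N powr \<delta>"
    and ext: "extremal A \<delta> N L P"
    and dec: "line_weighted_cell_decomposition A \<delta> N r L P {1..r\<^sup>2} C"
    and r_ge: "\<exists>\<epsilon>\<in>{0..\<delta>}. N powr (1/3 - \<epsilon>) \<le> A * real r"
    and P': "P' = (\<Union>i\<in>{i\<in>{1..r\<^sup>2}. card (C i) \<le> N powr (1/3 + 10 * \<delta>)}. C i)"
  shows "N powr (4/3 - \<delta>) \<le> 2 * A * card (incidences L P')"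
    and "N powr (1 - 2 * \<delta>) \<le> 24 * A * card P'"
proof -
  have conf: "finite L" "finite P" "\<forall>l\<in>L. is_line l" "card L \<le> N" "card P \<le> N"
    using ext by (auto simp: extremal_def configuration_def)
  have part: "disjoint_family_on C {1..r\<^sup>2}" "(\<Union>i\<in>{1..r\<^sup>2}. C i) = P"
    using dec by (auto simp: line_weighted_cell_decomposition_def cell_partition_def)
  define s where "s = N powr (4/3 - 2 * \<delta>)"
  define I' where "I' = real (card (incidences L P'))"
  have s: "s > 0" using N by (simp add: s_def)
  have pp: "N powr a * N powr b = N powr (a + b)" for a b by (simp add: powr_add)
  have pd: "N powr a / N powr b = N powr (a - b)" for a b by (simp add: powr_diff)
  have p2: "(N powr a)\<^sup>2 = N powr (2 * a)" for a by (simp add: power2_eq_square pp)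
  have mono: "N powr a \<le> N powr b" if "a \<le> b" for a b using that N by (rule powr_mono)
  have r1: "N powr (1/3 - \<delta>) \<le> A * real r" using powr_minus_mono[OF N r_ge] .
  moreover have "N powr (1/3 - \<delta>) > 0" using N by simp
  ultimately have "real r > 0" using A by (metis less_le_trans zero_less_mult_pos)
  have I_ge: "N powr (4/3 - \<delta>) \<le> A * card (incidences L P)"
    using ext N by (intro powr_minus_mono) (auto simp: extremal_def)
  have s_eq: "N powr (4/3 - \<delta>) = N powr \<delta> * s" by (simp add: s_def pp)
  \<comment> \<open>The bound \<open>A * N powr (1 + \<epsilon>) / r\<close> on the lines meeting a
    cell, after inserting the lower bound for \<open>r\<close>.\<close>
  define n where "n = A\<^sup>2 * N powr (2/3 + 2 * \<delta>)"
  \<comment> \<open>Chosen so that \<open>N * x = s\<close>.\<close>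
  define x where "x = N powr (1/3 - 2 * \<delta>)"
  \<comment> \<open>With \<open>n / x = A\<^sup>2 * N powr (1/3 + 4 * \<delta>)\<close>, the loss
    \<open>10 * \<delta>\<close> is exactly what makes \<open>N / m * (n / x)\<^sup>2\<close> equal
    to \<open>A ^ 4 * s\<close>.\<close>
  define m where "m = N powr (1/3 + 10 * \<delta>)"
  define H where "H = {i\<in>{1..r\<^sup>2}. m < card (C i)}"
  have few: "real (card {l\<in>L. \<exists>p\<in>C i. p \<in> l}) \<le> n" if "i \<in> H" for i
  proof -
    obtain \<epsilon> where \<epsilon>: "\<epsilon> \<le> \<delta>" "real (card {l\<in>L. \<exists>p\<in>C i. p \<in> l}) \<le> A * (N powr (1 + \<epsilon>) / real r)"
      using dec \<open>i \<in> H\<close> by (auto simp: line_weighted_cell_decomposition_def H_def)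
    have "N powr (1 + \<epsilon>) \<le> N powr (2/3 + 2 * \<delta>) * N powr (1/3 - \<delta>)"
      unfolding pp by (rule mono) (use \<epsilon> in simp)
    also have "\<dots> \<le> N powr (2/3 + 2 * \<delta>) * (A * r)"
      using r1 by (intro mult_left_mono) auto
    finally have "N powr (1 + \<epsilon>) / r \<le> N powr (2/3 + 2 * \<delta>) * A"
      using \<open>real r > 0\<close> by (simp add: field_simps)
    then have "A * (N powr (1 + \<epsilon>) / r) \<le> A * (N powr (2/3 + 2 * \<delta>) * A)"
      using A by (intro mult_left_mono) auto
    also have "\<dots> = n" by (simp add: n_def power2_eq_square)
    finally show ?thesis using \<epsilon> by linarith
  qed
  have n0: "n \<ge> 0" by (simp add: n_def)
  have x1: "x \<ge> 1" using N \<delta> by (simp add: x_def ge_one_powr_ge_zero)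
  have m0: "m > 0" using N by (simp add: m_def)
  have "real (card (incidences L (\<Union>i\<in>H. C i))) \<le> card P / m * (n + (n / x)\<^sup>2) + 6 * card P * x"
  proof (rule cells_incidence_bound)
    show "disjoint_family_on C H"
      using part(1) by (auto simp: disjoint_family_on_def H_def)
  qed (use conf part few x1 m0 n0 in \<open>auto simp: H_def\<close>)
  also have "\<dots> \<le> N / m * (n + (n / x)\<^sup>2) + 6 * N * x"
    using conf(5) n0 x1 m0 by (intro add_mono mult_right_mono divide_right_mono mult_left_mono) auto
  also have "\<dots> = N / m * n + N / m * (n / x)\<^sup>2 + 6 * (N * x)"
    by (simp add: algebra_simps)
  also have "\<dots> \<le> A\<^sup>2 * s + A ^ 4 * s + 6 * s"
  proof (intro add_mono)
    have "N / m * n = A\<^sup>2 * (N powr 1 / m * N powr (2/3 + 2 * \<delta>))" using N by (simp add: n_def)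
    also have "\<dots> = A\<^sup>2 * N powr (4/3 - 8 * \<delta>)" by (simp only: m_def pd pp) simp
    also have "\<dots> \<le> A\<^sup>2 * s" unfolding s_def using \<delta> by (intro mult_left_mono mono) auto
    finally show "N / m * n \<le> A\<^sup>2 * s" .
    have "N / m * (n / x)\<^sup>2 = A ^ 4 * (N powr 1 / m * (N powr (2/3 + 2 * \<delta>) / x)\<^sup>2)"
      using N by (simp add: n_def power_mult_distrib power_divide)
    also have "\<dots> = A ^ 4 * s" by (simp only: m_def x_def s_def pd pp p2) simp
    finally show "N / m * (n / x)\<^sup>2 \<le> A ^ 4 * s" by simp
    have "N * x = N powr 1 * x" using N by simp
    also have "\<dots> = s" by (simp only: x_def s_def pp) simp
    finally show "6 * (N * x) \<le> 6 * s" by simp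
  qed
  finally have heavy: "real (card (incidences L (\<Union>i\<in>H. C i))) \<le> (A\<^sup>2 + A ^ 4 + 6) * s"
    by (simp add: algebra_simps)
  have "{1..r\<^sup>2} = {i\<in>{1..r\<^sup>2}. card (C i) \<le> N powr (1/3 + 10 * \<delta>)} \<union> H"
    unfolding H_def m_def by (rule set_eqI) (simp, linarith)
  then have P: "P = P' \<union> (\<Union>i\<in>H. C i)"
    unfolding P' part(2)[symmetric] by (metis UN_Un)
  then have fin: "finite P'" using conf(2) by simp
  have "incidences L P = incidences L P' \<union> incidences L (\<Union>i\<in>H. C i)"
    unfolding P incidences_def by blast
  then have "card (incidences L P) \<le> card (incidences L P') + card (incidences L (\<Union>i\<in>H. C i))"
    by (simp add: card_Un_le)
  then have "real (card (incidences L P)) \<le> I' + (A\<^sup>2 + A ^ 4 + 6) * s"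
    using heavy unfolding I'_def by linarith
  then have I_le: "A * card (incidences L P) \<le> A * (I' + (A\<^sup>2 + A ^ 4 + 6) * s)"
    using A by (intro mult_left_mono) auto
  have large: "(2 * A * (A\<^sup>2 + A ^ 4 + 6) + 8 * A) * s \<le> N powr (4/3 - \<delta>)"
    unfolding s_eq using N_large s by (intro mult_right_mono) auto
  have As: "A * s \<ge> 0" "A * ((A\<^sup>2 + A ^ 4 + 6) * s) \<ge> 0" using A s by auto
  have "N powr (4/3 - \<delta>) \<le> 2 * (A * I')"
    using I_le I_ge large As by (simp add: algebra_simps)
  then show inc: "N powr (4/3 - \<delta>) \<le> 2 * A * card (incidences L P')"
    by (simp add: I'_def)
  \<comment> \<open>Now Szemeredi-Trotter for all lines and the kept points at once: this
    \<open>z\<close> gives \<open>(N / z)\<^sup>2 = s\<close>, so the terms without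
    \<open>card P'\<close> are at most \<open>2 * s\<close>.\<close>
  define z where "z = N powr (1/3 + \<delta>)"
  have z1: "z \<ge> 1" using N \<delta> by (simp add: z_def ge_one_powr_ge_zero)
  have "I' \<le> card L + 6 * card P' * z + (card L / z)\<^sup>2"
    unfolding I'_def using conf fin z1 by (intro szemeredi_trotter) auto
  moreover have "(card L / z)\<^sup>2 \<le> (N / z)\<^sup>2"
    using conf z1 by (intro power_mono divide_right_mono) auto
  moreover have "(N / z)\<^sup>2 = s"
  proof -
    have "(N powr 1 / z)\<^sup>2 = s" by (simp only: z_def s_def pd p2) simp
    then show ?thesis using N by simp
  qed
  moreover have "card L \<le> s"
  proof -
    have "N powr 1 \<le> s" unfolding s_def using \<delta> by (intro mono) auto
    then show ?thesis using conf(4) N by simp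
  qed
  ultimately have "I' \<le> 2 * s + 6 * card P' * z" by linarith
  then have "A * I' \<le> A * (2 * s + 6 * card P' * z)"
    using A by (intro mult_left_mono) auto
  then have "N powr (4/3 - \<delta>) \<le> 24 * A * card P' * z"
    using \<open>N powr (4/3 - \<delta>) \<le> 2 * (A * I')\<close> large As by (simp add: algebra_simps)
  moreover have "N powr (4/3 - \<delta>) = N powr (1 - 2 * \<delta>) * z"
    by (simp add: z_def pp)
  ultimately show "N powr (1 - 2 * \<delta>) \<le> 24 * A * card P'"
    using z1 by simp
qed

text \<open>The constant \<open>A'\<close> dominates all the losses: \<open>24 * A\<close> from the
  size of \<open>P'\<close>, \<open>2 * A\<close> from its incidences and \<open>A\<^sup>2\<close>
  from squaring the upper bound for \<open>r\<close>. The exponent \<open>10 * \<delta>\<close> is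
  that of the threshold for light cells.\<close>

lemma ex_point_weighted_subset:
  fixes A A' \<delta> N :: real and r :: nat
  assumes A: "A > 0" and \<delta>: "0 < \<delta>" "\<delta> \<le> 1/100"
    and A'_eq: "A' = 24 * A + A\<^sup>2"
    and N: "N \<ge> 1" "2 * A * (A\<^sup>2 + A ^ 4 + 6) + 8 * A \<le> N powr \<delta>"
    and ext: "extremal A \<delta> N L P"
    and dec: "line_weighted_cell_decomposition A \<delta> N r L P {1..r\<^sup>2} C"
    and r_ge: "\<exists>\<epsilon>\<in>{0..\<delta>}. N powr (1/3 - \<epsilon>) \<le> A * real r"
    and r_le: "real r \<le> A * N powr (1/3)"
  shows "\<exists>P'\<subseteq>P.
    (\<exists>\<epsilon>\<in>{0..10 * \<delta>}. N powr (1 - \<epsilon>) \<le> A' * real (card P')) \<and>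
    extremal A' (10 * \<delta>) N L P' \<and>
    point_weighted_cell_decomposition A' (10 * \<delta>) N r L P'
      {i \<in> {1..r\<^sup>2}. C i \<inter> P' \<noteq> {}} (\<lambda>i. C i \<inter> P')"
proof -
  have A': "A \<le> A'" "2 * A \<le> A'" "24 * A \<le> A'" "A\<^sup>2 \<le> A'"
    using A by (auto simp: A'_eq)
  define m where "m = N powr (1/3 + 10 * \<delta>)"
  define P' where "P' = (\<Union>i\<in>{i\<in>{1..r\<^sup>2}. card (C i) \<le> m}. C i)"
  let ?I = "{i \<in> {1..r\<^sup>2}. C i \<inter> P' \<noteq> {}}"
  note bounds = light_cells[OF A \<delta> N ext dec r_ge P'_def[unfolded m_def]]
  have conf: "configuration A \<delta> N L P" using ext by (simp add: extremal_def)
  have part: "disjoint_family_on C {1..r\<^sup>2}" "(\<Union>i\<in>{1..r\<^sup>2}. C i) = P"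
    and lines: "few_cells_per_line A r L {1..r\<^sup>2} C"
    using dec by (auto simp: line_weighted_cell_decomposition_def cell_partition_def)
  have "P' \<subseteq> P" using part(2) by (auto simp: P'_def)
  have weaken: "a * real k \<le> A' * real k" if "a \<le> A'" for a k
    using that by (intro mult_right_mono) auto
  have card_P': "N powr (1 - 2 * \<delta>) \<le> A' * card P'"
    using bounds(2) weaken[of "24 * A" "card P'"] A' by linarith
  then have card_P'_ex: "\<exists>\<epsilon>\<in>{0..10 * \<delta>}. N powr (1 - \<epsilon>) \<le> A' * real (card P')"
    using \<delta> by (intro bexI[of _ "2 * \<delta>"]) auto
  moreover have "extremal A' (10 * \<delta>) N L P'"
  proof -
    have "N powr (4/3 - \<delta>) \<le> A' * card (incidences L P')"
      using bounds(1) weaken[of "2 * A" "card (incidences L P')"] A' by linarith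
    then have inc: "\<exists>\<epsilon>\<in>{0..10 * \<delta>}. N powr (4/3 - \<epsilon>) \<le> A' * card (incidences L P')"
      using \<delta> by (intro bexI[of _ \<delta>]) auto
    obtain \<epsilon> where "\<epsilon> \<in> {0..\<delta>}" "N powr (1 - \<epsilon>) \<le> A * card L"
      using conf by (auto simp: configuration_def)
    then have card_L: "\<exists>\<epsilon>\<in>{0..10 * \<delta>}. N powr (1 - \<epsilon>) \<le> A' * card L"
      using \<delta> weaken[OF A'(1), of "card L"] by (intro bexI[of _ \<epsilon>]) auto
    have fin: "finite P'" "card P' \<le> N"
      using conf \<open>P' \<subseteq> P\<close> card_mono[of P P'] finite_subset[of P' P]
      by (auto simp: configuration_def intro: order_trans[OF of_nat_mono])
    show ?thesis
      unfolding extremal_def configuration_def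
      using conf inc card_L card_P'_ex fin by (auto simp: configuration_def)
  qed
  moreover have "point_weighted_cell_decomposition A' (10 * \<delta>) N r L P' ?I (\<lambda>i. C i \<inter> P')"
  proof -
    have "card ?I \<le> card {1..r\<^sup>2}" by (intro card_mono) auto
    moreover have "(\<Union>i\<in>?I. C i \<inter> P') = P'" by (auto simp: P'_def)
    moreover have "disjoint_family_on (\<lambda>i. C i \<inter> P') ?I"
      using part(1) unfolding disjoint_family_on_def by blast
    ultimately have "cell_partition r P' ?I (\<lambda>i. C i \<inter> P')"
      by (simp add: cell_partition_def)
    moreover have "few_cells_per_line A' r L ?I (\<lambda>i. C i \<inter> P')"
      unfolding few_cells_per_line_def
    proof
      fix l assume "l \<in> L"
      have "card {i\<in>?I. \<exists>p\<in>C i \<inter> P'. p \<in> l} \<le> card {i\<in>{1..r\<^sup>2}. \<exists>p\<in>C i. p \<in> l}"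
        by (intro card_mono) auto
      moreover have "real (card {i\<in>{1..r\<^sup>2}. \<exists>p\<in>C i. p \<in> l}) \<le> A * r"
        using lines \<open>l \<in> L\<close> by (auto simp: few_cells_per_line_def)
      ultimately show "real (card {i\<in>?I. \<exists>p\<in>C i \<inter> P'. p \<in> l}) \<le> A' * real r"
        using weaken[OF A'(1), of r] by linarith
    qed
    moreover have "real (card (C i \<inter> P')) \<le> A' * (N powr (1 + 10 * \<delta>) / (real r)\<^sup>2)"
      if i: "i \<in> ?I" for i
    proof -
      \<comment> \<open>\<open>C i\<close> meets \<open>P'\<close>, hence meets some light cell
        \<open>C j\<close>; by disjointness \<open>i = j\<close>, so \<open>C i\<close> is itself
        light.\<close>
      obtain j where "j \<in> {1..r\<^sup>2}" "card (C j) \<le> m" "C i \<inter> C j \<noteq> {}"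
        using i by (auto simp: P'_def)
      then have "card (C i) \<le> m"
        using i part(1) by (cases "i = j") (auto simp: disjoint_family_on_def)
      moreover have "finite (C i)"
        using i part(2) conf by (auto simp: configuration_def intro: finite_subset)
      then have "card (C i \<inter> P') \<le> card (C i)" by (intro card_mono) auto
      ultimately have "real (card (C i \<inter> P')) \<le> m" by linarith
      \<comment> \<open>Here the upper bound for \<open>r\<close> enters: \<open>r\<^sup>2\<close>
        is at most \<open>A\<^sup>2 * N powr (2/3)\<close>, which turns the threshold near
        \<open>N powr (1/3)\<close> into one near \<open>N / r\<^sup>2\<close>.\<close>
      also have "m \<le> A' * (N powr (1 + 10 * \<delta>) / (real r)\<^sup>2)"
      proof -
        have "r > 0" using i by (cases "r = 0") auto
        have "(real r)\<^sup>2 \<le> (A * N powr (1/3))\<^sup>2"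
          using r_le by (intro power_mono) auto
        also have "\<dots> = A\<^sup>2 * N powr (2/3)"
          by (simp add: power_mult_distrib power2_eq_square flip: powr_add)
        also have "\<dots> \<le> A' * N powr (2/3)"
          using A' by (intro mult_right_mono) auto
        finally have "m * (real r)\<^sup>2 \<le> m * (A' * N powr (2/3))"
          by (intro mult_left_mono) (auto simp: m_def)
        also have "\<dots> = A' * N powr (1 + 10 * \<delta>)"
          by (simp add: m_def flip: powr_add)
        finally show ?thesis using \<open>r > 0\<close> by (simp add: field_simps)
      qed
      finally show ?thesis .
    qed
    ultimately show ?thesis
      unfolding point_weighted_cell_decomposition_def using \<delta>
      by (intro conjI bexI[of _ "10 * \<delta>"]) auto
  qed
  ultimately show ?thesis using \<open>P' \<subseteq> P\<close> by blast
qed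

theorem theorem2p5:
  "\<forall>K>0. \<exists>K'>0. \<forall>\<^sub>F \<epsilon>\<^sub>0 :: real in at_right 0.
     \<forall>A>0. \<exists>A'>0. \<forall>\<^sub>F N :: real in at_top.
       \<forall>(r :: nat) (L :: (real^2) set set) (P :: (real^2) set) (C :: nat \<Rightarrow> (real^2) set).
         extremal A (K * \<epsilon>\<^sub>0) N L P \<longrightarrow>
         line_weighted_cell_decomposition A (K * \<epsilon>\<^sub>0) N r L P {1..r\<^sup>2} C \<longrightarrow>
         (\<exists>\<epsilon>\<in>{0..K * \<epsilon>\<^sub>0}. N powr (1/3 - \<epsilon>) \<le> A * real r) \<longrightarrow>
         real r \<le> A * N powr (1/3) \<longrightarrow>
         (\<exists>P'\<subseteq>P.
            (\<exists>\<epsilon>\<in>{0..K' * \<epsilon>\<^sub>0}. N powr (1 - \<epsilon>) \<le> A' * real (card P')) \<and>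
            extremal A' (K' * \<epsilon>\<^sub>0) N L P' \<and>
            point_weighted_cell_decomposition A' (K' * \<epsilon>\<^sub>0) N r L P'
              {i \<in> {1..r\<^sup>2}. C i \<inter> P' \<noteq> {}} (\<lambda>i. C i \<inter> P'))"
proof (intro allI impI, goal_cases)
  case (1 K)
  then have "10 * K > 0" by simp
  have small: "\<forall>\<^sub>F \<epsilon>\<^sub>0 :: real in at_right 0. 0 < K * \<epsilon>\<^sub>0 \<and> K * \<epsilon>\<^sub>0 \<le> 1/100"
    using \<open>K > 0\<close> eventually_at_right_real[of 0 "1 / (100 * K)"]
    by (auto elim!: eventually_mono simp: field_simps)
  show ?case
  \<comment> \<open>The factor 10 is the one in the threshold for light cells, so \<open>K'\<close>
    depends on \<open>K\<close> alone.\<close>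
  proof (rule exI[of _ "10 * K"], intro conjI \<open>10 * K > 0\<close> eventually_mono[OF small] allI impI,
      goal_cases)
    case (1 \<epsilon>\<^sub>0 A)
    define \<delta> where "\<delta> = K * \<epsilon>\<^sub>0"
    have \<delta>: "0 < \<delta>" "\<delta> \<le> 1/100" and \<delta>': "10 * K * \<epsilon>\<^sub>0 = 10 * \<delta>" and A: "A > 0"
      using 1 by (auto simp: \<delta>_def)
    have "filterlim (\<lambda>N::real. N powr \<delta>) at_top at_top"
      using \<delta> by real_asymp
    \<comment> \<open>A fixed positive \<open>\<delta>\<close> lets a power of \<open>N\<close>
      absorb every constant built from \<open>A\<close>; how large \<open>N\<close> must be depends
      on \<open>A\<close> and \<open>\<delta>\<close> but not on the configuration.\<close>
    then have large: "\<forall>\<^sub>F N :: real in at_top.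
        N \<ge> 1 \<and> 2 * A * (A\<^sup>2 + A ^ 4 + 6) + 8 * A \<le> N powr \<delta>"
      by (intro eventually_conj eventually_ge_at_top) (simp add: filterlim_at_top)
    have pos: "24 * A + A\<^sup>2 > 0" using A by (simp add: add_pos_nonneg)
    show ?case
      unfolding \<delta>' unfolding \<delta>_def[symmetric]
      by (rule exI[of _ "24 * A + A\<^sup>2"], intro conjI pos eventually_mono[OF large] allI impI
          ex_point_weighted_subset[OF A \<delta> refl]) auto
  qed
qed

end
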